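(* For any integer $q\ge 2$ there exists a constant $C>0$ such that for any integer $k\ge 2$, any $q$-colouring of the edges of the complete graph on $n=\lceil Ck\ln k\rceil$ vertices, and any $(\rho_1,\dots,\rho_q)\in(0,1)^q$ with $\sum_{i=1}^q\rho_i=1$, there exist a colour $j\in\{1,\dots,q\}$ and a set $S$ of vertices, of size $\ell\ge k$, such that the graph induced by $S$ in colour $j$ has minimum degree at least $\rho_j(\ell-1)$.
   Context: A $q$-colouring of the edges of a complete graph is an arbitrary map from the edge set to $\{1,\dots,q\}$. The graph induced by $S$ in colour $j$ has vertex set $S$ and, as edges, the edges of colour $j$ with both endpoints in $S$. The constant $C$ depends only on $q$; the $\rho_i$ may depend on $k$. $\ln$ is the natural logarithm. *)

theory Defs
  imports Complex_Main "HOL-Library.Ramsey" "HOL-Library.FuncSet"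
begin

text \<open>
  A finite simple graph is a pair \<open>(V, E)\<close> whose edges are two-element subsets of \<open>V\<close>.
  The complete graph on \<open>V\<close> has edge set \<open>[V]\<^bsup>2\<^esup>\<close> (\<^const>\<open>nsets\<close>).
\<close>

definition vertex_degree :: "'v set \<times> 'v set set \<Rightarrow> 'v \<Rightarrow> nat" where
  "vertex_degree G v = card {e \<in> snd G. v \<in> e}"

text \<open>Meaningful only for a finite, nonempty vertex set, because of \<^const>\<open>Min\<close>.\<close>

definition min_degree :: "'v set \<times> 'v set set \<Rightarrow> nat" where
  "min_degree G = Min (vertex_degree G ` fst G)"

definition edge_colouring :: "nat \<Rightarrow> 'v set \<Rightarrow> ('v set \<Rightarrow> nat) \<Rightarrow> bool" where
  "edge_colouring q V c \<longleftrightarrow> c \<in> [V]\<^bsup>2\<^esup> \<rightarrow> {1..q}"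

definition induced_colour_graph ::
    "('v set \<Rightarrow> nat) \<Rightarrow> nat \<Rightarrow> 'v set \<Rightarrow> 'v set \<times> 'v set set" where
  "induced_colour_graph c j S = (S, {e \<in> [S]\<^bsup>2\<^esup>. c e = j})"

end

theory Submission
  imports Defs
begin

text \<open>
  Give the edge \<open>{u, v}\<close> the weight \<open>1 - \<rho>\<^sub>j\<close> in colour \<open>j\<close> if it has that colour and \<open>- \<rho>\<^sub>j\<close>
  otherwise.  The surplus of \<open>S\<close> in colour \<open>j\<close> is the total weight inside \<open>S\<close>, and because the
  \<open>\<rho>\<^sub>j\<close> sum to one, the surpluses of a fixed set over all colours cancel.  If no vertex can be
  deleted from \<open>S\<close> so as to increase the surplus in colour \<open>j\<close>, then every vertex of \<open>S\<close> has
  colour-\<open>j\<close> degree at least \<open>\<rho>\<^sub>j (\<bar>S\<bar> - 1)\<close> (\<open>max_surplus_imp_row_nonneg\<close>); so a set of largest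
  surplus, over all sets and colours, is what is wanted unless it has fewer than \<open>k\<close> vertices.

  Suppose it is always too small.  Remove a set of largest surplus from the vertex set, then a set
  of largest surplus from what is left, and so on, with surpluses \<open>d\<^sub>1 \<ge> d\<^sub>2 \<ge> \<dots>\<close>.  Take two removed
  sets \<open>X\<close>, \<open>Y\<close> of the same colour, \<open>X\<close> earlier.  Since \<open>X \<union> Y\<close> was available when \<open>X\<close> was chosen,
  the weight between \<open>X\<close> and \<open>Y\<close> is at most minus the surplus of \<open>Y\<close>.  The union of many removed
  sets of the same colour thus has a very negative surplus in that colour
  (\<open>surplus_Union_le\<close>), hence a large surplus in another colour; but that surplus is at most the
  first \<open>d\<^sub>i\<close> involved.  So the \<open>d\<^sub>i\<close> halve within a number of rounds that depends only on \<open>q\<close>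
  (\<open>greedy_max_surplus_halves\<close>).

  They start below \<open>k\<^sup>2\<close>, since the first set is small, and they stay at least \<open>1\<close> as long as \<open>k\<close>
  vertices are left (surplus is counted over ordered pairs): at most one \<open>\<rho>\<^sub>j\<close> exceeds \<open>1/2\<close>, so
  either all remaining edges have one colour and the remaining vertices are a valid set \<open>S\<close>, or some
  edge has a colour with \<open>\<rho>\<^sub>i \<le> 1/2\<close> and its two ends have surplus \<open>2 (1 - \<rho>\<^sub>i)\<close>.  Hence there are
  only \<open>O(ln k)\<close> rounds, each of which removes fewer than \<open>k\<close> vertices.
\<close>

section \<open>Surplus of a vertex set\<close>

definition surplus :: "('v \<Rightarrow> 'v \<Rightarrow> real) \<Rightarrow> 'v set \<Rightarrow> real" where
  "surplus w S = (\<Sum>u\<in>S. \<Sum>v\<in>S. w u v)"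

lemma surplus_Un:
  assumes "finite A" "finite B" "A \<inter> B = {}" "\<And>u v. w u v = w v u"
  shows "surplus w (A \<union> B) = surplus w A + surplus w B + 2 * (\<Sum>u\<in>A. \<Sum>v\<in>B. w u v)"
proof -
  have "(\<Sum>u\<in>B. \<Sum>v\<in>A. w u v) = (\<Sum>u\<in>A. \<Sum>v\<in>B. w u v)"
    by (subst sum.swap) (intro sum.cong refl assms(4))
  then show ?thesis
    using assms(1-3) by (simp add: surplus_def sum.union_disjoint sum.distrib)
qed

text \<open>
  Deleting \<open>v\<close> from \<open>S\<close> lowers the surplus by twice the weight of the row of \<open>v\<close>.
\<close>
lemma max_surplus_imp_row_nonneg:
  assumes "finite S" "v \<in> S" "\<And>u v. w u v = w v u" "w v v = 0"
    and "surplus w (S - {v}) \<le> surplus w S"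
  shows "0 \<le> (\<Sum>u\<in>S. w v u)"
proof -
  have "surplus w ({v} \<union> (S - {v})) = surplus w (S - {v}) + 2 * (\<Sum>u\<in>S - {v}. w v u)"
    using assms(1,4) by (subst surplus_Un[OF _ _ _ assms(3)]) (auto simp: surplus_def)
  moreover have "{v} \<union> (S - {v}) = S"
    using assms(2) by auto
  moreover have "(\<Sum>u\<in>S. w v u) = (\<Sum>u\<in>S - {v}. w v u)"
    using assms(1,2,4) by (simp add: sum.remove)
  ultimately show ?thesis
    using assms(5) by simp
qed

text \<open>
  The hypothesis on \<open>surplus w (A i \<union> A l)\<close> says that joining a later set to an earlier one does not
  help, so the weight between them (over ordered pairs) is at most \<open>- surplus w (A l) \<le> - d\<close>.  So a
  set with \<open>m \<ge> 1\<close> predecessors raises the surplus of the union by at most \<open>(1 - m) d\<close>, which is \<open>0\<close>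
  for the second set and at most \<open>- d\<close> for each set after it.  The truncated
  subtraction makes the bound right for a single set as well.
\<close>
lemma surplus_Union_le:
  fixes A :: "nat \<Rightarrow> 'v set"
  assumes sym: "\<And>u v. w u v = w v u" and "0 \<le> d"
    and "finite J" "J \<noteq> {}"
    and "\<And>i. i \<in> J \<Longrightarrow> finite (A i)"
    and "\<And>i. i \<in> J \<Longrightarrow> d \<le> surplus w (A i) \<and> surplus w (A i) \<le> D"
    and "\<And>i l. i \<in> J \<Longrightarrow> l \<in> J \<Longrightarrow> i < l \<Longrightarrow> A i \<inter> A l = {}"
    and "\<And>i l. i \<in> J \<Longrightarrow> l \<in> J \<Longrightarrow> i < l \<Longrightarrow> surplus w (A i \<union> A l) \<le> surplus w (A i)"
  shows "surplus w (\<Union>i\<in>J. A i) \<le> D - d * real (card J - 2)"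
  using assms(3-)
proof (induction J rule: finite_linorder_max_induct)
  case empty
  then show ?case by simp
next
  case (insert l J)
  show ?case
  proof (cases "J = {}")
    case True
    then show ?thesis using insert.prems(3)[of l] by simp
  next
    case False
    let ?U = "\<Union>i\<in>J. A i"
    have IH: "surplus w ?U \<le> D - d * real (card J - 2)"
    proof (rule insert.IH[OF False])
      show "finite (A i)" "d \<le> surplus w (A i) \<and> surplus w (A i) \<le> D" if "i \<in> J" for i
        using insert.prems(2,3)[of i] that by simp_all
      show "A i \<inter> A i' = {}" "surplus w (A i \<union> A i') \<le> surplus w (A i)"
        if "i \<in> J" "i' \<in> J" "i < i'" for i i'
        using insert.prems(4,5)[of i i'] that by simp_all
    qed
    have cross: "2 * (\<Sum>u\<in>A i. \<Sum>v\<in>A l. w u v) \<le> - surplus w (A l)" if "i \<in> J" for i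
    proof -
      have "i < l" using that insert.hyps by blast
      then have "surplus w (A i \<union> A l) \<le> surplus w (A i)" "A i \<inter> A l = {}"
        using insert.prems(4,5)[of i l] that by simp_all
      moreover have "finite (A i)" "finite (A l)"
        using insert.prems(2) that by simp_all
      ultimately show ?thesis
        using surplus_Un[of "A i" "A l" w, OF _ _ _ sym] by linarith
    qed
    have dl: "d \<le> surplus w (A l)"
      using insert.prems(3)[of l] by simp
    have disj: "\<forall>i\<in>J. \<forall>i'\<in>J. i \<noteq> i' \<longrightarrow> A i \<inter> A i' = {}"
    proof (intro ballI impI)
      fix i i' assume "i \<in> J" "i' \<in> J" "i \<noteq> i'"
      then show "A i \<inter> A i' = {}"
        using insert.prems(4)[of i i'] insert.prems(4)[of i' i] by (cases "i < i'") (simp_all add: Int_commute)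
    qed
    have "(\<Sum>u\<in>?U. \<Sum>v\<in>A l. w u v) = (\<Sum>i\<in>J. \<Sum>u\<in>A i. \<Sum>v\<in>A l. w u v)"
      using insert.prems(2) insert.hyps(1) disj by (intro sum.UNION_disjoint) simp_all
    then have "2 * (\<Sum>u\<in>?U. \<Sum>v\<in>A l. w u v) = (\<Sum>i\<in>J. 2 * (\<Sum>u\<in>A i. \<Sum>v\<in>A l. w u v))"
      by (simp only: sum_distrib_left)
    also have "\<dots> \<le> (\<Sum>i\<in>J. - surplus w (A l))"
      by (intro sum_mono cross)
    finally have c: "2 * (\<Sum>u\<in>?U. \<Sum>v\<in>A l. w u v) \<le> - (real (card J) * surplus w (A l))"
      by simp
    have "surplus w (?U \<union> A l) = surplus w ?U + surplus w (A l)
        + 2 * (\<Sum>u\<in>?U. \<Sum>v\<in>A l. w u v)"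
    proof (rule surplus_Un[OF _ _ _ sym])
      have "A i \<inter> A l = {}" if "i \<in> J" for i
        using insert.prems(4)[of i l] insert.hyps(2) that by simp
      then show "?U \<inter> A l = {}"
        by blast
    qed (use insert.prems(2) insert.hyps(1) in simp_all)
    also have "\<dots> \<le> surplus w ?U - (real (card J) - 1) * surplus w (A l)"
      using c by (simp add: algebra_simps)
    also have "\<dots> \<le> surplus w ?U - (real (card J) - 1) * d"
    proof -
      have "1 \<le> card J"
        using False insert.hyps(1) by (simp add: Suc_leI card_gt_0_iff)
      then show ?thesis
        using dl by (simp add: mult_left_mono)
    qed
    also have "\<dots> \<le> D - d * (real (card J - 2) + (real (card J) - 1))"
      using IH by (simp add: algebra_simps)
    also have "\<dots> \<le> D - d * real (card (insert l J) - 2)"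
    proof -
      have "l \<notin> J" "1 \<le> card J"
        using insert.hyps False by (auto simp: Suc_leI card_gt_0_iff)
      then have "real (card (insert l J) - 2) \<le> real (card J - 2) + (real (card J) - 1)"
        using insert.hyps(1) by (simp add: of_nat_diff)
      then show ?thesis
        using \<open>0 \<le> d\<close> by (simp add: mult_left_mono)
    qed
    finally show ?thesis
      by (simp add: Un_commute)
  qed
qed

section \<open>Greedy removal of sets of largest surplus\<close>

text \<open>
  The maximising set and colour are choice functions on all subsets of \<open>V\<close>, so that the removal can
  be iterated; below, \<open>D W\<close> is the largest surplus inside \<open>W\<close>, and \<open>R i\<close> what is left of \<open>V\<close> after
  \<open>i\<close> rounds.
\<close>
locale greedy_removal =
  fixes w :: "nat \<Rightarrow> 'v \<Rightarrow> 'v \<Rightarrow> real" and q :: nat and V :: "'v set"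
    and A :: "'v set \<Rightarrow> 'v set" and col :: "'v set \<Rightarrow> nat"
  assumes sym: "w j u v = w j v u"
    and cancel: "u \<in> V \<Longrightarrow> v \<in> V \<Longrightarrow> (\<Sum>j\<in>{1..q}. w j u v) = 0"
    and finite_V: "finite V"
    and q_pos: "0 < q"
    and A_subset: "W \<subseteq> V \<Longrightarrow> A W \<subseteq> W"
    and col_in: "W \<subseteq> V \<Longrightarrow> col W \<in> {1..q}"
    and maximal: "W \<subseteq> V \<Longrightarrow> S \<subseteq> W \<Longrightarrow> j \<in> {1..q} \<Longrightarrow>
      surplus (w j) S \<le> surplus (w (col W)) (A W)"
begin

definition D :: "'v set \<Rightarrow> real" where
  "D W = surplus (w (col W)) (A W)"

definition R :: "nat \<Rightarrow> 'v set" where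
  "R i = ((\<lambda>W. W - A W) ^^ i) V"

lemma R_0: "R 0 = V" and R_Suc: "R (Suc i) = R i - A (R i)"
  by (simp_all add: R_def)

lemma R_antimono: "i \<le> l \<Longrightarrow> R l \<subseteq> R i"
  by (rule lift_Suc_antimono_le[of R]) (auto simp: R_Suc)

lemma R_subset: "R i \<subseteq> V"
  using R_antimono[of 0 i] by (simp add: R_0)

lemma D_mono: "W \<subseteq> W' \<Longrightarrow> W' \<subseteq> V \<Longrightarrow> D W \<le> D W'"
  unfolding D_def by (meson A_subset col_in maximal order_trans)

lemma D_nonneg: "W \<subseteq> V \<Longrightarrow> 0 \<le> D W"
  using maximal[of W "{}" 1] q_pos by (simp add: D_def surplus_def)

text \<open>
  This is where the cancellation of the colours enters: a very negative surplus in one colour forces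
  a large surplus in one of the other \<open>q - 1\<close> colours.
\<close>
lemma surplus_lower_bound:
  assumes "W \<subseteq> V" "S \<subseteq> W" "j \<in> {1..q}"
  shows "- (real q - 1) * D W \<le> surplus (w j) S"
proof -
  have "(\<Sum>i\<in>{1..q}. surplus (w i) S) = (\<Sum>u\<in>S. \<Sum>v\<in>S. \<Sum>i\<in>{1..q}. w i u v)"
    unfolding surplus_def by (subst sum.swap, rule sum.cong[OF refl], rule sum.swap)
  also have "\<dots> = 0"
    using assms(1,2) by (intro sum.neutral ballI cancel) auto
  finally have "surplus (w j) S = - (\<Sum>i\<in>{1..q} - {j}. surplus (w i) S)"
    using assms(3) by (simp add: sum.remove)
  moreover have "(\<Sum>i\<in>{1..q} - {j}. surplus (w i) S) \<le> real (card ({1..q} - {j})) * D W"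
    using assms maximal unfolding D_def by (intro sum_bounded_above) auto
  moreover have "real (card ({1..q} - {j})) = real q - 1"
    using assms(3) q_pos by (simp add: of_nat_diff)
  ultimately show ?thesis
    by (simp only: mult_minus_left neg_le_iff_le)
qed

text \<open>
  Among \<open>q (2 q + 2)\<close> rounds, \<open>2 q + 2\<close> have the same colour.  Their union has surplus at most
  \<open>D (R s) - 2 q d\<close> in that colour, where \<open>d\<close> is the surplus at the end, and at least
  \<open>- (q - 1) D (R s)\<close>, so that \<open>2 d \<le> D (R s)\<close>.
\<close>
lemma greedy_max_surplus_halves: "2 * D (R (s + q * (2 * q + 2))) \<le> D (R s)"
proof -
  define m where "m = 2 * q + 2"
  define N where "N = {s..<s + q * m}"
  let ?d = "D (R (s + q * m))"
  let ?X = "\<lambda>i. A (R i)"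
  have "\<exists>j\<in>{1..q}. m \<le> card {i\<in>N. col (R i) = j}"
  proof (rule ccontr)
    assume "\<not> ?thesis"
    then have "(\<Sum>j\<in>{1..q}. card {i\<in>N. col (R i) = j}) < (\<Sum>j\<in>{1..q}. m)"
      using q_pos by (intro sum_strict_mono) (auto simp: not_le)
    moreover have "(\<Sum>j\<in>{1..q}. card {i\<in>N. col (R i) = j}) = card N"
      using sum_fun_comp[of N "{1..q}" "\<lambda>i. col (R i)" "\<lambda>_. 1::nat"] col_in[OF R_subset]
      by (simp add: N_def image_subset_iff)
    ultimately show False
      by (simp add: N_def)
  qed
  then obtain j where j: "j \<in> {1..q}" and big: "m \<le> card {i\<in>N. col (R i) = j}"
    by blast
  define J where "J = {i\<in>N. col (R i) = j}"
  have finJ: "finite J"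
    by (simp add: J_def N_def)
  have nonempty: "J \<noteq> {}"
    using big unfolding J_def m_def by force
  have J_range: "s \<le> i" "i < s + q * m" and D_J: "surplus (w j) (?X i) = D (R i)" if "i \<in> J" for i
    using that by (auto simp: J_def N_def D_def)
  have later: "?X l \<subseteq> R i - ?X i" if "i < l" for i l
    using A_subset[OF R_subset, of l] R_antimono[of "Suc i" l] that by (auto simp: R_Suc)
  have upper: "surplus (w j) (\<Union>i\<in>J. ?X i) \<le> D (R s) - ?d * real (card J - 2)"
  proof (rule surplus_Union_le[OF sym])
    show "?d \<le> surplus (w j) (?X i) \<and> surplus (w j) (?X i) \<le> D (R s)" if "i \<in> J" for i
      using J_range[OF that] D_J[OF that] by (auto intro!: D_mono R_antimono R_subset)
    show "surplus (w j) (?X i \<union> ?X l) \<le> surplus (w j) (?X i)" if "i \<in> J" "l \<in> J" "i < l" for i l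
    proof -
      have "?X i \<union> ?X l \<subseteq> R i"
        using later[OF \<open>i < l\<close>] A_subset[OF R_subset] by blast
      then have "surplus (w j) (?X i \<union> ?X l) \<le> D (R i)"
        unfolding D_def using maximal[OF R_subset _ j] by blast
      then show ?thesis
        using D_J[OF \<open>i \<in> J\<close>] by simp
    qed
    show "finite (?X i)" for i
      using finite_V A_subset[OF R_subset] R_subset by (meson finite_subset)
    show "?X i \<inter> ?X l = {}" if "i < l" for i l
      using later[OF that] by blast
  qed (use D_nonneg[OF R_subset] finJ nonempty in simp_all)
  have "(\<Union>i\<in>J. ?X i) \<subseteq> R s"
    using A_subset[OF R_subset] R_antimono J_range(1) by blast
  then have lower: "- (real q - 1) * D (R s) \<le> surplus (w j) (\<Union>i\<in>J. ?X i)"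
    using surplus_lower_bound[OF R_subset _ j] by blast
  have "2 * q \<le> card J - 2"
    using big by (simp add: J_def m_def)
  then have "?d * (2 * real q) \<le> ?d * real (card J - 2)"
    using D_nonneg[OF R_subset] by (intro mult_left_mono) linarith+
  also have "\<dots> \<le> real q * D (R s)"
    using upper lower by (simp add: algebra_simps)
  finally have "real q * (2 * ?d) \<le> real q * D (R s)"
    by (simp add: algebra_simps)
  then show ?thesis
    using q_pos by (simp add: m_def)
qed

lemma greedy_max_surplus_decay: "2 ^ r * D (R (r * (q * (2 * q + 2)))) \<le> D V"
proof (induction r)
  case 0
  then show ?case by (simp add: R_0)
next
  case (Suc r)
  have "2 ^ Suc r * D (R (Suc r * (q * (2 * q + 2))))
      = 2 ^ r * (2 * D (R (r * (q * (2 * q + 2)) + q * (2 * q + 2))))"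
    by (simp add: add.commute)
  also have "\<dots> \<le> 2 ^ r * D (R (r * (q * (2 * q + 2))))"
    by (intro mult_left_mono greedy_max_surplus_halves) simp
  finally show ?case
    using Suc.IH by linarith
qed

lemma card_R:
  assumes "\<And>W. W \<subseteq> V \<Longrightarrow> card (A W) \<le> k"
  shows "card V \<le> card (R i) + i * k"
proof (induction i)
  case 0
  then show ?case by (simp add: R_0)
next
  case (Suc i)
  have "card (R i) - card (A (R i)) \<le> card (R (Suc i))"
    unfolding R_Suc using finite_V by (meson A_subset R_subset diff_card_le_card_Diff finite_subset)
  then show ?case
    using Suc.IH assms[OF R_subset, of i] by simp
qed

end

lemma ex_max_surplus:
  fixes q :: nat
  assumes "finite W" "0 < q"
  shows "\<exists>S j. S \<subseteq> W \<and> j \<in> {1..q} \<and>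
    (\<forall>S' \<subseteq> W. \<forall>j'\<in>{1..q}. surplus (w j') S' \<le> surplus (w j) S)"
proof -
  let ?P = "Pow W \<times> {1..q}"
  have "finite ?P" "?P \<noteq> {}"
    using assms by auto
  then obtain p where p: "p \<in> ?P"
      "surplus (w (snd p)) (fst p) = (MAX p\<in>?P. surplus (w (snd p)) (fst p))"
    by (rule obtains_MAX[where f = "\<lambda>p. surplus (w (snd p)) (fst p)"]) auto
  have "surplus (w (snd p')) (fst p') \<le> surplus (w (snd p)) (fst p)" if "p' \<in> ?P" for p'
    unfolding p(2) using \<open>finite ?P\<close> that by (intro Max_ge) auto
  with p(1) show ?thesis
    by (intro exI[of _ "fst p"] exI[of _ "snd p"]) force
qed

section \<open>Edge colourings\<close>

definition colour_weight :: "('v set \<Rightarrow> nat) \<Rightarrow> (nat \<Rightarrow> real) \<Rightarrow> nat \<Rightarrow> 'v \<Rightarrow> 'v \<Rightarrow> real" where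
  "colour_weight c \<rho> j u v = (if u = v then 0 else of_bool (c {u, v} = j) - \<rho> j)"

lemma colour_weight_sym: "colour_weight c \<rho> j u v = colour_weight c \<rho> j v u"
  by (simp add: colour_weight_def insert_commute)

lemma sum_colour_weight:
  assumes "edge_colouring q V c" "(\<Sum>i\<in>{1..q}. \<rho> i) = 1" "u \<in> V" "v \<in> V"
  shows "(\<Sum>j\<in>{1..q}. colour_weight c \<rho> j u v) = 0"
proof (cases "u = v")
  case False
  then have "{u, v} \<in> [V]\<^bsup>2\<^esup>"
    using assms(3,4) by (simp add: nsets_def)
  then have "c {u, v} \<in> {1..q}"
    using assms(1) by (auto simp: edge_colouring_def)
  then show ?thesis
    using False assms(2) by (simp add: colour_weight_def sum_subtractf of_bool_def)
qed (simp add: colour_weight_def)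

lemma vertex_degree_induced_colour_graph:
  assumes "v \<in> S"
  shows "vertex_degree (induced_colour_graph c j S) v = card {u \<in> S - {v}. c {v, u} = j}"
proof -
  have "{e \<in> [S]\<^bsup>2\<^esup>. c e = j \<and> v \<in> e} = (\<lambda>u. {v, u}) ` {u \<in> S - {v}. c {v, u} = j}"
    using assms by (auto simp: nsets_2_eq insert_commute)
  moreover have "inj_on (\<lambda>u. {v, u}) {u \<in> S - {v}. c {v, u} = j}"
    by (auto simp: inj_on_def doubleton_eq_iff)
  ultimately show ?thesis
    by (simp add: vertex_degree_def induced_colour_graph_def card_image)
qed

text \<open>
  The row sum of \<open>v\<close> is its colour-\<open>j\<close> degree inside \<open>S\<close> minus \<open>\<rho> j\<close> times the number of other
  vertices of \<open>S\<close>.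
\<close>
lemma min_degree_ge_if_rows_nonneg:
  assumes "finite S" "S \<noteq> {}"
    and "\<And>v. v \<in> S \<Longrightarrow> 0 \<le> (\<Sum>u\<in>S. colour_weight c \<rho> j v u)"
  shows "\<rho> j * (real (card S) - 1) \<le> real (min_degree (induced_colour_graph c j S))"
proof -
  let ?G = "induced_colour_graph c j S"
  have deg: "\<rho> j * (real (card S) - 1) \<le> real (vertex_degree ?G v)" if v: "v \<in> S" for v
  proof -
    have "(\<Sum>u\<in>S. colour_weight c \<rho> j v u) = (\<Sum>u\<in>S - {v}. of_bool (c {v, u} = j) - \<rho> j)"
      using assms(1) v by (auto simp: sum.remove colour_weight_def intro!: sum.cong split: if_splits)
    also have "\<dots> = real (card {u \<in> S - {v}. c {v, u} = j}) - \<rho> j * real (card (S - {v}))"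
      using assms(1) by (simp add: sum_subtractf sum_of_bool_eq Int_def)
    also have "real (card (S - {v})) = real (card S) - 1"
      using assms(1) v by (metis Diff_empty card_Diff_insert card_gt_0_iff card_Diff_singleton
        empty_iff of_nat_1 of_nat_diff Suc_leI One_nat_def)
    finally show ?thesis
      using assms(3)[OF v] vertex_degree_induced_colour_graph[OF v, of c j] by simp
  qed
  have "min_degree ?G \<in> vertex_degree ?G ` S"
    using assms(1,2) Min_in[of "vertex_degree ?G ` S"]
    by (simp add: min_degree_def induced_colour_graph_def)
  then show ?thesis
    using deg by auto
qed

lemma surplus_colour_weight_le:
  assumes "0 \<le> \<rho> j"
  shows "surplus (colour_weight c \<rho> j) S \<le> (real (card S))\<^sup>2"
proof -
  have "surplus (colour_weight c \<rho> j) S \<le> (\<Sum>u\<in>S. \<Sum>v\<in>S. 1)"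
    unfolding surplus_def using assms by (intro sum_mono) (auto simp: colour_weight_def)
  then show ?thesis
    by (simp add: power2_eq_square)
qed

text \<open>
  Two colours with \<open>\<rho> i > 1/2\<close> are impossible, so if no edge has a colour with \<open>\<rho> i \<le> 1/2\<close>, all
  edges have the same colour, and all weights in that colour are nonnegative.
\<close>
lemma monochromatic_or_surplus_ge_1:
  assumes col: "edge_colouring q W c" and "2 \<le> card W"
    and \<rho>: "\<And>i. i \<in> {1..q} \<Longrightarrow> 0 < \<rho> i \<and> \<rho> i < 1" and sum: "(\<Sum>i\<in>{1..q}. \<rho> i) = 1"
  shows "(\<exists>j\<in>{1..q}. \<forall>v\<in>W. 0 \<le> (\<Sum>u\<in>W. colour_weight c \<rho> j v u)) \<or>
    (\<exists>j\<in>{1..q}. \<exists>S\<subseteq>W. 1 \<le> surplus (colour_weight c \<rho> j) S)"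
proof (cases "\<exists>u\<in>W. \<exists>v\<in>W. u \<noteq> v \<and> \<rho> (c {u, v}) \<le> 1/2")
  case True
  then obtain u v where uv: "u \<in> W" "v \<in> W" "u \<noteq> v" "\<rho> (c {u, v}) \<le> 1/2"
    by blast
  have "c {u, v} \<in> {1..q}"
    using col uv by (auto simp: edge_colouring_def nsets_def)
  moreover have "1 \<le> surplus (colour_weight c \<rho> (c {u, v})) {u, v}"
    using uv by (simp add: surplus_def colour_weight_def insert_commute)
  ultimately show ?thesis
    using uv by blast
next
  case False
  have range: "c {u, v} \<in> {1..q}" if "u \<in> W" "v \<in> W" "u \<noteq> v" for u v
    using col that by (auto simp: edge_colouring_def nsets_def)
  have "\<exists>a\<in>W. \<exists>b\<in>W. a \<noteq> b"
    using \<open>2 \<le> card W\<close> by (metis card_le_Suc0_iff_eq card.infinite not_less_eq_eq numeral_2_eq_2 zero_le)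
  then obtain a b where ab: "a \<in> W" "b \<in> W" "a \<noteq> b"
    by blast
  let ?j = "c {a, b}"
  have same: "c {u, v} = ?j" if uv: "u \<in> W" "v \<in> W" "u \<noteq> v" for u v
  proof (rule ccontr)
    assume "c {u, v} \<noteq> ?j"
    then have "\<rho> (c {u, v}) + \<rho> ?j = (\<Sum>i\<in>{c {u, v}, ?j}. \<rho> i)"
      by simp
    also have "\<dots> \<le> (\<Sum>i\<in>{1..q}. \<rho> i)"
      using range[OF uv] range[OF ab] \<rho> by (intro sum_mono2) (auto simp: less_imp_le)
    finally have "\<rho> (c {u, v}) + \<rho> ?j \<le> 1"
      using sum by simp
    moreover have "1/2 < \<rho> (c {u, v})" "1/2 < \<rho> ?j"
      using False uv ab by (meson not_le)+
    ultimately show False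
      by linarith
  qed
  have "\<forall>v\<in>W. 0 \<le> (\<Sum>u\<in>W. colour_weight c \<rho> ?j v u)"
    using same \<rho>[OF range[OF ab]] by (intro ballI sum_nonneg) (auto simp: colour_weight_def)
  then show ?thesis
    using range[OF ab] by blast
qed

section \<open>Counting the rounds\<close>

text \<open>
  With \<open>r\<close> such that \<open>2 ^ r \<ge> k\<^sup>2\<close>, the largest surplus would drop from less than \<open>k\<^sup>2\<close> to less than
  \<open>1\<close> within \<open>r q (2 q + 2)\<close> rounds, while at least \<open>k\<close> vertices survive them.
\<close>
lemma ex_colour_set_large_min_degree:
  fixes V :: "'v set"
  assumes "0 < q" "2 \<le> k" "finite V" and col: "edge_colouring q V c"
    and \<rho>: "\<And>i. i \<in> {1..q} \<Longrightarrow> 0 < \<rho> i \<and> \<rho> i < 1" and sum: "(\<Sum>i\<in>{1..q}. \<rho> i) = 1"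
    and r: "k\<^sup>2 \<le> 2 ^ r" and V: "r * (q * (2 * q + 2)) * k + k \<le> card V"
  shows "\<exists>j\<in>{1..q}. \<exists>S\<subseteq>V. k \<le> card S \<and>
    \<rho> j * (real (card S) - 1) \<le> real (min_degree (induced_colour_graph c j S))"
proof (rule ccontr)
  assume contr: "\<not> ?thesis"
  define w where "w = colour_weight c \<rho>"
  let ?rows = "\<lambda>j S. \<forall>v\<in>S. 0 \<le> (\<Sum>u\<in>S. w j v u)"
  have no_large: "card S < k" if "j \<in> {1..q}" "S \<subseteq> V" "?rows j S" for j S
  proof (rule ccontr)
    assume "\<not> card S < k"
    moreover from this have "S \<noteq> {}" "finite S"
      using \<open>2 \<le> k\<close> \<open>finite V\<close> that(2) by (auto intro: finite_subset)
    ultimately show False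
      using contr that min_degree_ge_if_rows_nonneg[of S c \<rho> j] unfolding w_def by force
  qed
  have "\<forall>W. \<exists>S j. W \<subseteq> V \<longrightarrow> S \<subseteq> W \<and> j \<in> {1..q} \<and>
      (\<forall>S' \<subseteq> W. \<forall>j'\<in>{1..q}. surplus (w j') S' \<le> surplus (w j) S)"
    using ex_max_surplus[of _ q w] \<open>finite V\<close> \<open>0 < q\<close> by (meson finite_subset)
  then obtain A cl where A: "\<And>W. W \<subseteq> V \<Longrightarrow> A W \<subseteq> W \<and> cl W \<in> {1..q} \<and>
      (\<forall>S' \<subseteq> W. \<forall>j'\<in>{1..q}. surplus (w j') S' \<le> surplus (w (cl W)) (A W))"
    by metis
  interpret greedy_removal w q V A cl
  proof
    show "w j u v = w j v u" for j u v
      unfolding w_def by (rule colour_weight_sym)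
    show "(\<Sum>j\<in>{1..q}. w j u v) = 0" if "u \<in> V" "v \<in> V" for u v
      using sum_colour_weight[OF col sum that] by (simp add: w_def)
  qed (use A assms in blast)+
  have small: "card (A W) < k" if W: "W \<subseteq> V" for W
  proof (rule no_large[of "cl W"])
    show "?rows (cl W) (A W)"
    proof
      fix v assume "v \<in> A W"
      moreover have "surplus (w (cl W)) (A W - {v}) \<le> surplus (w (cl W)) (A W)"
        using A_subset[OF W] col_in[OF W] by (intro maximal[OF W]) auto
      moreover have "finite (A W)"
        using A_subset[OF W] W finite_V by (meson finite_subset)
      ultimately show "0 \<le> (\<Sum>u\<in>A W. w (cl W) v u)"
        using colour_weight_def[of c \<rho> "cl W" v v]
        by (intro max_surplus_imp_row_nonneg[OF _ _ sym]) (simp_all add: w_def)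
    qed
  qed (use A_subset[OF W] col_in[OF W] W in auto)
  let ?W = "R (r * (q * (2 * q + 2)))"
  have W: "?W \<subseteq> V"
    by (rule R_subset)
  have "k \<le> card ?W"
    using card_R[of k "r * (q * (2 * q + 2))"] small V by (auto simp: less_imp_le)
  then have not_rows: "\<not> (\<exists>j\<in>{1..q}. ?rows j ?W)"
    using no_large[OF _ W] by (meson not_le)
  have "edge_colouring q ?W c"
    using col nsets_mono[OF W, of 2] by (auto simp: edge_colouring_def)
  then have "\<exists>j\<in>{1..q}. \<exists>S\<subseteq>?W. 1 \<le> surplus (w j) S"
    using monochromatic_or_surplus_ge_1[of q ?W c \<rho>] \<open>k \<le> card ?W\<close> \<open>2 \<le> k\<close> \<rho> sum not_rows
    unfolding w_def by fastforce
  then have "1 \<le> D ?W"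
    unfolding D_def using maximal[OF W] by (meson order_trans)
  then have "2 ^ r \<le> 2 ^ r * D ?W"
    by simp
  also have "\<dots> \<le> D V"
    by (rule greedy_max_surplus_decay)
  also have "\<dots> \<le> (real (card (A V)))\<^sup>2"
    using \<rho>[OF col_in[of V]] unfolding D_def by (simp add: w_def surplus_colour_weight_le)
  also have "\<dots> < (real k)\<^sup>2"
    using small[of V] by (intro power_strict_mono) auto
  also have "\<dots> \<le> 2 ^ r"
    using r by (metis of_nat_le_iff of_nat_power of_nat_numeral)
  finally show False
    by simp
qed

theorem corollary8:
  fixes q :: nat
  assumes "q \<ge> 2"
  shows "\<exists>C::real. C > 0 \<and>
    (\<forall>k::nat. k \<ge> 2 \<longrightarrow>
      (\<forall>n::nat. int n = \<lceil>C * real k * ln (real k)\<rceil> \<longrightarrow>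
        (\<forall>(c :: nat set \<Rightarrow> nat) (\<rho> :: nat \<Rightarrow> real).
          edge_colouring q {1..n} c \<longrightarrow>
          (\<forall>i\<in>{1..q}. 0 < \<rho> i \<and> \<rho> i < 1) \<longrightarrow>
          (\<Sum>i\<in>{1..q}. \<rho> i) = 1 \<longrightarrow>
          (\<exists>j\<in>{1..q}. \<exists>S\<subseteq>{1..n}. card S \<ge> k \<and>
            real (min_degree (induced_colour_graph c j S)) \<ge> \<rho> j * (real (card S) - 1)))))"
proof -
  define L where "L = q * (2 * q + 2)"
  \<comment> \<open>\<open>L r k + k\<close> vertices suffice if \<open>2 ^ r \<ge> k\<^sup>2\<close>.  With \<open>r = \<lceil>2 log 2 k\<rceil>\<close>, \<open>log 2 k \<ge> 1\<close> gives
      \<open>r \<le> 3 log 2 k\<close>, so this number is at most \<open>(3 L + 1) k log 2 k\<close>.\<close>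
  define C where "C = (3 * real L + 1) / ln 2"
  have "C > 0"
    by (simp add: C_def add_nonneg_pos)
  moreover have "\<exists>j\<in>{1..q}. \<exists>S\<subseteq>{1..n}. card S \<ge> k \<and>
      real (min_degree (induced_colour_graph c j S)) \<ge> \<rho> j * (real (card S) - 1)"
    if k: "k \<ge> 2" and n: "int n = \<lceil>C * real k * ln (real k)\<rceil>"
      and col: "edge_colouring q {1..n} c" and \<rho>: "\<forall>i\<in>{1..q}. 0 < \<rho> i \<and> \<rho> i < 1"
      and sum: "(\<Sum>i\<in>{1..q}. \<rho> i) = 1"
    for k n :: nat and c :: "nat set \<Rightarrow> nat" and \<rho> :: "nat \<Rightarrow> real"
  proof -
    define r where "r = nat \<lceil>2 * log 2 (real k)\<rceil>"
    have log_ge: "1 \<le> log 2 (real k)"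
      using k by (simp add: le_log_iff)
    then have r_le: "real r \<le> 3 * log 2 (real k)" and r_ge: "2 * log 2 (real k) \<le> real r"
      unfolding r_def by linarith+
    have "(real k)\<^sup>2 = 2 powr (2 * log 2 (real k))"
      using k by (simp add: powr_powr[symmetric] mult.commute[of 2] powr_realpow)
    also have "\<dots> \<le> 2 ^ r"
      using r_ge by (simp add: powr_realpow[symmetric])
    finally have r: "k\<^sup>2 \<le> 2 ^ r"
      by (metis of_nat_le_iff of_nat_power of_nat_numeral)
    have "real (r * L * k + k) = real k * (real L * real r + 1)"
      by (simp add: algebra_simps)
    also have "\<dots> \<le> real k * (real L * (3 * log 2 (real k)) + log 2 (real k))"
      using r_le log_ge by (intro mult_left_mono add_mono) auto
    also have "\<dots> = C * real k * ln (real k)"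
      by (simp add: C_def log_def field_simps)
    also have "\<dots> \<le> real n"
      using n by linarith
    finally have "r * (q * (2 * q + 2)) * k + k \<le> card {1..n}"
      unfolding L_def card_atLeastAtMost by linarith
    then show ?thesis
      using ex_colour_set_large_min_degree[OF _ k _ col _ sum r] \<rho> assms by simp
  qed
  ultimately show ?thesis
    by blast
qed

end
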